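(* Let $K$ be a field, $L=L_0\oplus L_1$ a (left) Leibniz superalgebra over $K$, and $\mu_t=\sum_{i\ge0}\mu_it^i$ a formal one-parameter deformation of $L$. Then the infinitesimal $\mu_1\in C_0^2(L;L)$ of $\mu_t$ is a cocycle, i.e. $\delta^2\mu_1=0$. In general, if $\mu_n$ is the $n$-infinitesimal of $\mu_t$ for some $n\ge1$ (that is, $\mu_i=0$ for $1\le i\le n-1$ and $\mu_n\neq0$), then $\mu_n$ is a cocycle in $C_0^2(L;L)$, i.e. $\delta^2\mu_n=0$.
   Context: Fix a field $K$. In a $\mathbb{Z}_2$-graded space, a homogeneous element appearing in an exponent of $-1$ stands for its degree: $(-1)^{ab}=(-1)^{\deg(a)\deg(b)}$. A (left) Leibniz superalgebra is a $\mathbb{Z}_2$-graded $K$-vector space $L=L_0\oplus L_1$ with a bilinear map $[-,-]:L\times L\to L$ such that $[L_\alpha,L_\beta]\subseteq L_{\alpha+\beta}$ and $[[a,b],c]=[a,[b,c]]-(-1)^{ab}[b,[a,c]]$ for all homogeneous $a,b,c\in L$. $L[[t]]$ denotes formal power series with coefficients in $L$, a module over $K[[t]]$. A formal one-parameter deformation of $L$ is a $K[[t]]$-bilinear map $\mu_t:L[[t]]\times L[[t]]\to L[[t]]$ such that (a) $\mu_t(a,b)=\sum_{i=0}^\infty\mu_i(a,b)t^i$ for all $a,b\in L$, where each $\mu_i:L\times L\to L$ is $K$-bilinear and homogeneous of degree $0$ (i.e. $\mu_i(L_\alpha,L_\beta)\subseteq L_{\alpha+\beta}$) and $\mu_0(a,b)=[a,b]$;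 (b) $\mu_t(\mu_t(a,b),c)=\mu_t(a,\mu_t(b,c))-(-1)^{ab}\mu_t(b,\mu_t(a,c))$ for all homogeneous $a,b,c\in L$. The cochain $\mu_1$ is called the infinitesimal of $\mu_t$. If $\mu_i=0$ for $1\le i\le n-1$ and $\mu_n\ne0$, then $\mu_n$ is called the $n$-infinitesimal of $\mu_t$. $C_0^2(L;L)$ is the space of $K$-bilinear maps $g:L\times L\to L$ homogeneous of degree $0$. For such $g$ and homogeneous $x_1,x_2,x_3\in L$, $$\begin{aligned}\delta^2g(x_1,x_2,x_3)={}&-g([x_1,x_2],x_3)-(-1)^{x_1x_2}g(x_2,[x_1,x_3])+g(x_1,[x_2,x_3])\\&+[x_1,g(x_2,x_3)]-(-1)^{x_1x_2}[x_2,g(x_1,x_3)]-[g(x_1,x_2),x_3],\end{aligned}$$ and $g$ is a cocycle if $\delta^2g=0$. *)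

theory Defs
  imports
    "HOL-Computational_Algebra.Formal_Power_Series"
    "HOL-Library.Z2"
begin

definition bilinear_map ::
  "('r::comm_ring_1 \<Rightarrow> 'v::ab_group_add \<Rightarrow> 'v) \<Rightarrow> ('v \<Rightarrow> 'v \<Rightarrow> 'v) \<Rightarrow> bool" where
  "bilinear_map s f \<longleftrightarrow>
     (\<forall>x. module_hom s s (\<lambda>y. f x y)) \<and> (\<forall>y. module_hom s s (\<lambda>x. f x y))"

(* The K[[t]]-module structure on L[[t]]: for L over K with scalar multiplication s,
   the coefficient of t^n in f x is the Cauchy sum below. *)
definition fps_scale ::
  "('k::comm_ring_1 \<Rightarrow> 'v::ab_group_add \<Rightarrow> 'v) \<Rightarrow> 'k fps \<Rightarrow> 'v fps \<Rightarrow> 'v fps" where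
  "fps_scale s f x = Abs_fps (\<lambda>n. \<Sum>i=0..n. s (fps_nth f i) (fps_nth x (n - i)))"

lemma (in module) module_fps_scale: "module (fps_scale scale)"
proof
  fix f g :: "'a fps" and x y :: "'b fps"
  show "fps_scale scale f (x + y) = fps_scale scale f x + fps_scale scale f y"
    by (simp add: fps_scale_def fps_eq_iff scale_right_distrib sum.distrib)
  show "fps_scale scale (f + g) x = fps_scale scale f x + fps_scale scale g x"
    by (simp add: fps_scale_def fps_eq_iff scale_left_distrib sum.distrib)
  show "fps_scale scale f (fps_scale scale g x) = fps_scale scale (f * g) x"
  proof (rule fps_ext)
    fix n
    have "(\<Sum>j=0..n. \<Sum>i=0..j. (fps_nth f i * fps_nth g (j - i)) *s fps_nth x (n - j)) =
          (\<Sum>j=0..n. \<Sum>i=0..n - j. (fps_nth f j * fps_nth g i) *s fps_nth x (n - j - i))"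
      by (rule fps_mult_assoc_lemma)
    then show "fps_nth (fps_scale scale f (fps_scale scale g x)) n =
               fps_nth (fps_scale scale (f * g) x) n"
      by (simp add: fps_scale_def fps_mult_nth scale_sum_left scale_sum_right)
  qed
  have "(\<Sum>i=0..n. fps_nth 1 i *s fps_nth x (n - i)) = fps_nth x n" for n
    by (simp add: sum.atLeast_Suc_atMost)
  then show "fps_scale scale 1 x = x"
    by (simp add: fps_scale_def fps_eq_iff)
qed

locale superspace = vector_space scale
  for scale :: "'k::field \<Rightarrow> 'v::ab_group_add \<Rightarrow> 'v" (infixr \<open>*s\<close> 75) +
  fixes L :: "bit \<Rightarrow> 'v set"
  assumes subspace_L: "subspace (L \<alpha>)"
    and L_Int: "L 0 \<inter> L 1 = {0}"
    and L_sum: "\<exists>a\<in>L 0. \<exists>b\<in>L 1. x = a + b"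
begin

definition homogeneous :: "'v \<Rightarrow> bool" where
  "homogeneous x \<longleftrightarrow> (\<exists>\<alpha>. x \<in> L \<alpha>)"

(* Meaningful for homogeneous x only. The zero vector lies in both components and gets
   degree 0; the choice is immaterial, since each term carrying a sign is linear in the
   elements that determine the sign. *)
definition deg :: "'v \<Rightarrow> bit" where
  "deg x = (if x \<in> L 0 then 0 else 1)"

lemma deg_eq: "x \<in> L \<alpha> \<Longrightarrow> x \<noteq> 0 \<Longrightarrow> deg x = \<alpha>"
  using L_Int by (cases \<alpha>) (auto simp: deg_def)

(* (-1)^{ab}, taken in K or in K[[t]] according to context. *)
definition ksign :: "'v \<Rightarrow> 'v \<Rightarrow> 'r::ring_1" where
  "ksign a b = (- 1) ^ (of_bit (deg a) * of_bit (deg b))"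

definition C02 :: "('v \<Rightarrow> 'v \<Rightarrow> 'v) set" where
  "C02 = {g. bilinear_map scale g \<and> (\<forall>\<alpha> \<beta>. \<forall>x\<in>L \<alpha>. \<forall>y\<in>L \<beta>. g x y \<in> L (\<alpha> + \<beta>))}"

end

locale leibniz_superalgebra = superspace scale L
  for scale :: "'k::field \<Rightarrow> 'v::ab_group_add \<Rightarrow> 'v" (infixr \<open>*s\<close> 75)
    and L :: "bit \<Rightarrow> 'v set" +
  fixes br :: "'v \<Rightarrow> 'v \<Rightarrow> 'v" (\<open>\<lbrakk>_,_\<rbrakk>\<close>)
  assumes br_C02: "br \<in> C02"
    and leibniz: "homogeneous a \<Longrightarrow> homogeneous b \<Longrightarrow> homogeneous c \<Longrightarrow>
      \<lbrakk>\<lbrakk>a,b\<rbrakk>,c\<rbrakk> = \<lbrakk>a,\<lbrakk>b,c\<rbrakk>\<rbrakk> - ksign a b *s \<lbrakk>b,\<lbrakk>a,c\<rbrakk>\<rbrakk>"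
begin

(* An element a of L is viewed in L[[t]] as the constant series fps_const a. *)
definition formal_deformation ::
  "('v fps \<Rightarrow> 'v fps \<Rightarrow> 'v fps) \<Rightarrow> (nat \<Rightarrow> 'v \<Rightarrow> 'v \<Rightarrow> 'v) \<Rightarrow> bool" where
  "formal_deformation \<mu>t \<mu> \<longleftrightarrow>
     bilinear_map (fps_scale scale) \<mu>t \<and>
     (\<forall>a b. \<mu>t (fps_const a) (fps_const b) = Abs_fps (\<lambda>i. \<mu> i a b)) \<and>
     (\<forall>i. \<mu> i \<in> C02) \<and>
     (\<forall>a b. \<mu> 0 a b = \<lbrakk>a,b\<rbrakk>) \<and>
     (\<forall>a b c. homogeneous a \<longrightarrow> homogeneous b \<longrightarrow> homogeneous c \<longrightarrow>
        \<mu>t (\<mu>t (fps_const a) (fps_const b)) (fps_const c) =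
        \<mu>t (fps_const a) (\<mu>t (fps_const b) (fps_const c)) -
        fps_scale scale (ksign a b) (\<mu>t (fps_const b) (\<mu>t (fps_const a) (fps_const c))))"

(* The formula is the coboundary on homogeneous arguments only. *)
definition \<delta>2 :: "('v \<Rightarrow> 'v \<Rightarrow> 'v) \<Rightarrow> 'v \<Rightarrow> 'v \<Rightarrow> 'v \<Rightarrow> 'v" where
  "\<delta>2 g x1 x2 x3 =
     - g \<lbrakk>x1,x2\<rbrakk> x3 - ksign x1 x2 *s g x2 \<lbrakk>x1,x3\<rbrakk> + g x1 \<lbrakk>x2,x3\<rbrakk>
     + \<lbrakk>x1,g x2 x3\<rbrakk> - ksign x1 x2 *s \<lbrakk>x2,g x1 x3\<rbrakk> - \<lbrakk>g x1 x2,x3\<rbrakk>"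

definition cocycle :: "('v \<Rightarrow> 'v \<Rightarrow> 'v) \<Rightarrow> bool" where
  "cocycle g \<longleftrightarrow> g \<in> C02 \<and>
     (\<forall>x1 x2 x3. homogeneous x1 \<longrightarrow> homogeneous x2 \<longrightarrow> homogeneous x3 \<longrightarrow> \<delta>2 g x1 x2 x3 = 0)"

end

definition n_infinitesimal ::
  "(nat \<Rightarrow> 'v \<Rightarrow> 'v \<Rightarrow> 'v::zero) \<Rightarrow> nat \<Rightarrow> ('v \<Rightarrow> 'v \<Rightarrow> 'v) \<Rightarrow> bool" where
  "n_infinitesimal \<mu> n g \<longleftrightarrow>
     1 \<le> n \<and> (\<forall>i\<in>{1..<n}. \<mu> i = (\<lambda>_ _. 0)) \<and> g = \<mu> n \<and> g \<noteq> (\<lambda>_ _. 0)"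

end

theory Submission
  imports Defs
begin

text \<open>
  The deformed Leibniz identity is an identity of power series, and the cocycle condition is its
  first non-trivial coefficient. Since \<open>\<mu>t\<close> is linear over power series in each argument, it
  commutes with multiplication by \<open>t\<close>; hence the coefficient of \<open>t^n\<close> of a nested product depends
  only on the bilinear maps \<open>\<mu> i\<close>, and comparing coefficients yields
  \<open>\<Sum> \<mu> j (\<mu> i a b) c = \<Sum> \<mu> j a (\<mu> i b c) - (-1)^(ab) \<Sum> \<mu> j b (\<mu> i a c)\<close>,
  each sum running over \<open>i + j = n\<close>.
  If \<open>\<mu> i\<close> vanishes for \<open>0 < i < n\<close>, only the summands with \<open>i = 0\<close> or \<open>j = 0\<close> survive. As
  \<open>\<mu> 0\<close> is the bracket, these are exactly the six terms of the coboundary of \<open>\<mu> n\<close>. For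
  \<open>n = 1\<close> the vanishing condition is empty, so \<open>\<mu> 1\<close> is covered by the same argument.
\<close>

lemma fps_scale_X_nth:
  assumes "module s"
  shows "fps_nth (fps_scale s fps_X x) n = (if n = 0 then 0 else fps_nth x (n - 1))"
proof -
  interpret module s by fact
  have "fps_nth (fps_scale s fps_X x) n =
      (\<Sum>i=0..n. if i = 1 then fps_nth x (n - i) else 0)"
    unfolding fps_scale_def fps_nth_Abs_fps by (rule sum.cong) auto
  then show ?thesis by (simp add: sum.delta)
qed

text \<open>
  The series \<open>x\<close> is its constant term plus \<open>t\<close> times its shift, and the factor \<open>t\<close>, which
  passes through \<open>F\<close>, lowers the coefficient under consideration by one. So after finitely many
  such steps only values of \<open>F\<close> on constant series remain.
\<close>

lemma fps_linear_nth:
  assumes F: "module_hom (fps_scale s) (fps_scale s') F"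
    and s: "module s" and s': "module s'"
  shows "fps_nth (F x) n = (\<Sum>i=0..n. fps_nth (F (fps_const (fps_nth x i))) (n - i))"
proof -
  interpret F: module_hom "fps_scale s" "fps_scale s'" F by fact
  have split: "x = fps_const (fps_nth x 0) + fps_scale s fps_X (fps_shift 1 x)" for x
    by (rule fps_ext) (simp add: fps_scale_X_nth[OF s])
  have F_split: "F x = F (fps_const (fps_nth x 0)) + fps_scale s' fps_X (F (fps_shift 1 x))" for x
    by (subst split) (simp only: F.add F.scale)
  show ?thesis
  proof (induction n arbitrary: x)
    case 0
    show ?case
      by (subst F_split) (simp add: fps_scale_X_nth[OF s'])
  next
    case (Suc n)
    have "fps_nth (F x) (Suc n) =
        fps_nth (F (fps_const (fps_nth x 0))) (Suc n) + fps_nth (F (fps_shift 1 x)) n"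
      by (subst F_split) (simp add: fps_scale_X_nth[OF s'])
    also have "\<dots> = fps_nth (F (fps_const (fps_nth x 0))) (Suc n) +
        (\<Sum>i=0..n. fps_nth (F (fps_const (fps_nth x (Suc i)))) (n - i))"
      by (simp add: Suc.IH)
    also have "\<dots> = (\<Sum>i=0..Suc n. fps_nth (F (fps_const (fps_nth x i))) (Suc n - i))"
      by (simp add: sum.atLeast0_atMost_Suc_shift del: sum.cl_ivl_Suc)
    finally show ?case .
  qed
qed

context superspace
begin

text \<open>The sign on the left lives in \<open>K[[t]]\<close>, the one on the right in \<open>K\<close>.\<close>

lemma fps_scale_ksign_nth: "fps_nth (fps_scale scale (ksign a b) x) n = ksign a b *s fps_nth x n"
proof -
  interpret fps: module "fps_scale scale" by (rule module_fps_scale)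
  have "(ksign a b :: 'k fps) = 1 \<and> (ksign a b :: 'k) = 1 \<or>
        (ksign a b :: 'k fps) = - 1 \<and> (ksign a b :: 'k) = - 1"
    unfolding ksign_def by (cases "deg a"; cases "deg b") auto
  then show ?thesis by auto
qed

end

context leibniz_superalgebra
begin

text \<open>
  Each nested product is a value of \<open>\<mu>t\<close> with one constant argument. It is linear in the other
  one, whose coefficients are those of the innermost product of two constants.
\<close>

lemma deformation_identity_coefficient:
  assumes def: "formal_deformation \<mu>t \<mu>"
    and hom: "homogeneous a" "homogeneous b" "homogeneous c"
  shows "(\<Sum>i=0..n. \<mu> (n - i) (\<mu> i a b) c) =
    (\<Sum>i=0..n. \<mu> (n - i) a (\<mu> i b c)) - ksign a b *s (\<Sum>i=0..n. \<mu> (n - i) b (\<mu> i a c))"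
proof -
  have bil: "bilinear_map (fps_scale scale) \<mu>t"
    and const: "\<mu>t (fps_const x) (fps_const y) = Abs_fps (\<lambda>i. \<mu> i x y)" for x y
    using def unfolding formal_deformation_def by auto
  have left: "fps_nth (\<mu>t x (fps_const y)) n = (\<Sum>i=0..n. \<mu> (n - i) (fps_nth x i) y)" for x y
    using fps_linear_nth[of scale scale "\<lambda>x. \<mu>t x (fps_const y)"] bil
    by (simp add: bilinear_map_def const module_axioms)
  have right: "fps_nth (\<mu>t (fps_const x) y) n = (\<Sum>i=0..n. \<mu> (n - i) x (fps_nth y i))" for x y
    using fps_linear_nth[of scale scale "\<mu>t (fps_const x)"] bil
    by (simp add: bilinear_map_def const module_axioms)
  have "\<mu>t (\<mu>t (fps_const a) (fps_const b)) (fps_const c) =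
      \<mu>t (fps_const a) (\<mu>t (fps_const b) (fps_const c)) -
      fps_scale scale (ksign a b) (\<mu>t (fps_const b) (\<mu>t (fps_const a) (fps_const c)))"
    using def hom unfolding formal_deformation_def by blast
  from arg_cong[where f = "\<lambda>x. fps_nth x n", OF this] show ?thesis
    by (simp only: fps_sub_nth fps_scale_ksign_nth left right) (simp add: const)
qed

text \<open>
  Each of the three sums in the coefficient of \<open>t^n\<close> keeps two summands, \<open>i = 0\<close> and \<open>i = n\<close>;
  in both, one of the two products is the bracket and the other is \<open>\<mu> n\<close>.
\<close>

lemma cocycle_if_lower_terms_vanish:
  assumes def: "formal_deformation \<mu>t \<mu>"
    and n: "1 \<le> n" and vanish: "\<And>i. i \<in> {1..<n} \<Longrightarrow> \<mu> i = (\<lambda>_ _. 0)"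
  shows "cocycle (\<mu> n)"
proof -
  have C02: "\<mu> n \<in> C02" and \<mu>0: "\<mu> 0 x y = \<lbrakk>x,y\<rbrakk>" for x y
    using def unfolding formal_deformation_def by auto
  have ends: "(\<Sum>i=0..n. \<mu> (n - i) (p i) (q i)) = \<mu> n (p 0) (q 0) + \<lbrakk>p n,q n\<rbrakk>" for p q
  proof -
    \<comment> \<open>Applying the hypothesis to the outer index \<open>n - i\<close> makes the middle summands vanish
      whatever their arguments.\<close>
    have outer: "\<mu> (n - i) x y = 0" if "i \<in> {1..<n}" for i x y
      using vanish[of "n - i"] that by auto
    have "(\<Sum>i=0..n. \<mu> (n - i) (p i) (q i)) = (\<Sum>i\<in>{0,n}. \<mu> (n - i) (p i) (q i))"
      by (intro sum.mono_neutral_right) (auto intro!: outer)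
    then show ?thesis using n by (simp add: \<mu>0)
  qed
  have "\<delta>2 (\<mu> n) a b c = 0" if hom: "homogeneous a" "homogeneous b" "homogeneous c" for a b c
  proof -
    have "\<mu> n \<lbrakk>a,b\<rbrakk> c + \<lbrakk>\<mu> n a b,c\<rbrakk> =
        \<mu> n a \<lbrakk>b,c\<rbrakk> + \<lbrakk>a,\<mu> n b c\<rbrakk> - ksign a b *s (\<mu> n b \<lbrakk>a,c\<rbrakk> + \<lbrakk>b,\<mu> n a c\<rbrakk>)"
      using deformation_identity_coefficient[OF def hom, of n]
      by (simp only: ends \<mu>0)
    then show ?thesis
      unfolding \<delta>2_def by (simp add: scale_right_distrib algebra_simps)
  qed
  with C02 show ?thesis unfolding cocycle_def by blast
qed

end

theorem proposition5p1:
  fixes scale :: "'k::field \<Rightarrow> 'v::ab_group_add \<Rightarrow> 'v"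
    and L :: "bit \<Rightarrow> 'v set"
    and br :: "'v \<Rightarrow> 'v \<Rightarrow> 'v"
    and \<mu>t :: "'v fps \<Rightarrow> 'v fps \<Rightarrow> 'v fps"
    and \<mu> :: "nat \<Rightarrow> 'v \<Rightarrow> 'v \<Rightarrow> 'v"
  assumes "leibniz_superalgebra scale L br"
    and "leibniz_superalgebra.formal_deformation scale L br \<mu>t \<mu>"
  shows "leibniz_superalgebra.cocycle scale L br (\<mu> 1) \<and>
    (\<forall>n g. n_infinitesimal \<mu> n g \<longrightarrow> leibniz_superalgebra.cocycle scale L br g)"
proof -
  interpret leibniz_superalgebra scale L br by fact
  show ?thesis
    using cocycle_if_lower_terms_vanish[OF assms(2)] unfolding n_infinitesimal_def by auto
qed

end
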